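(* Let $G$ be a non-trivial group. If $G\not\cong\mathbb{Z}_2$, then the girth of the endomorphism graph of $G$ is $3$. Moreover, the endomorphism graph of $G$ is bipartite if and only if $G\cong\mathbb{Z}_2$.
   Context: The endomorphism graph of a group $G$ is the simple undirected graph with vertex set $G$ in which distinct $x,y$ are adjacent if and only if some endomorphism of $G$ maps $x$ to $y$ or maps $y$ to $x$. The girth of a graph is the length of its shortest cycle. *)

theory Defs
  imports
    "HOL-Algebra.Elementary_Groups"
    "HOL-Library.Extended_Nat"
    "Graph_Theory.Pair_Digraph"
begin

text \<open>
  Simple undirected graphs, possibly infinite, are represented as symmetric loop-free digraphs
  without parallel arcs: an edge between \<open>x\<close> and \<open>y\<close> is the pair of arcs
  \<open>(x, y)\<close>, \<open>(y, x)\<close>.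
\<close>

definition endomorphism_graph :: "('a, 'b) monoid_scheme \<Rightarrow> 'a pair_pre_digraph" where
  "endomorphism_graph G =
     \<lparr> pverts = carrier G,
       parcs = {(x, y). x \<in> carrier G \<and> y \<in> carrier G \<and> x \<noteq> y \<and>
                  (\<exists>f\<in>hom G G. f x = y \<or> f y = x)} \<rparr>"

lemma endomorphism_graph_bidirected: "pair_bidirected_digraph (endomorphism_graph G)"
  by unfold_locales (auto simp: endomorphism_graph_def symmetric_def sym_def)

text \<open>
  \<open>pre_digraph.cycle\<close> is the directed notion, under which an edge traversed back and forth is
  a cycle of length 2. In a symmetric loop-free digraph without parallel arcs, the cycles of the
  undirected graph are the directed ones of length at least 3. The girth is \<open>\<infinity>\<close> when there
  are none.
\<close>

definition girth :: "'a pair_pre_digraph \<Rightarrow> enat" where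
  "girth D = (INF p \<in> {p. pre_digraph.cycle (with_proj D) p \<and> 3 \<le> length p}. enat (length p))"

definition bipartite :: "'a pair_pre_digraph \<Rightarrow> bool" where
  "bipartite D \<longleftrightarrow>
     (\<exists>U V. pverts D = U \<union> V \<and> U \<inter> V = {} \<and>
        (\<forall>(x, y) \<in> parcs D. x \<in> U \<and> y \<in> V \<or> x \<in> V \<and> y \<in> U))"

end

theory Submission
  imports Defs
begin

text \<open>
  The trivial endomorphism makes the identity adjacent to every other vertex, so a triangle appears
  as soon as two distinct non-identity elements are adjacent, and three mutually adjacent vertices
  are at once a shortest possible cycle and an obstruction to bipartiteness.

  Such a pair exists in every group with more than two elements.
  A non-abelian group has an inner automorphism that moves some element; an abelian group with an
  element \<open>x\<close> such that \<open>x\<^sup>2 \<noteq> \<one>\<close> has the inversion automorphism. In the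
  remaining case \<open>G\<close> is abelian of exponent two, that is, a vector space over the field with
  two elements, and any non-zero vector is sent to any other vector by some linear map. The
  linear functional behind this is obtained from Zorn's lemma, as the characteristic function of
  the complement of a subgroup that is maximal among those avoiding \<open>x\<close>: such a subgroup has
  index two (\<open>exponent_two_hyperplane_avoiding\<close>).

  A group with exactly two elements is \<open>\<int>\<^sub>2\<close>, and its endomorphism graph is a single edge.
\<close>

section \<open>Endomorphisms moving a non-identity element\<close>

text \<open>
  A subgroup maximal among those avoiding \<open>x\<close> works. If \<open>z \<notin> H\<close>, then the subgroup
  \<open>H \<union> H z\<close> generated by \<open>H\<close> and \<open>z\<close> is strictly larger, hence contains \<open>x\<close>, and
  \<open>x \<in> H z\<close> amounts to \<open>z x \<in> H\<close> in exponent two. So the complement of \<open>H\<close>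
  is the single coset \<open>H x\<close>, which is the form in which index two is used below.
\<close>

lemma (in comm_group) exponent_two_hyperplane_avoiding:
  assumes exp2: "\<And>a. a \<in> carrier G \<Longrightarrow> a \<otimes> a = \<one>"
    and x: "x \<in> carrier G" "x \<noteq> \<one>"
  obtains H where "subgroup H G" "x \<notin> H" "\<And>z. z \<in> carrier G \<Longrightarrow> z \<notin> H \<Longrightarrow> z \<otimes> x \<in> H"
proof -
  let ?A = "{H. subgroup H G \<and> x \<notin> H}"
  have "\<exists>M\<in>?A. \<forall>X\<in>?A. M \<subseteq> X \<longrightarrow> X = M"
  proof (rule subset_Zorn_nonempty)
    show "?A \<noteq> {}"
      using triv_subgroup x by blast
  next
    fix C assume "C \<noteq> {}" and chain: "subset.chain ?A C"
    have sub: "subgroup H G" "x \<notin> H" if "H \<in> C" for H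
      using chain that by (auto simp: subset.chain_def)
    have "subgroup (\<Union>C) G"
    proof (rule subgroupI)
      show "\<Union>C \<subseteq> carrier G"
        using sub subgroup.subset by blast
      show "\<Union>C \<noteq> {}"
        using sub(1)[THEN subgroup.one_closed] \<open>C \<noteq> {}\<close> by auto
      show "inv a \<in> \<Union>C" if "a \<in> \<Union>C" for a
        using that sub(1)[THEN subgroup.m_inv_closed] by auto
      show "a \<otimes> b \<in> \<Union>C" if ab: "a \<in> \<Union>C" "b \<in> \<Union>C" for a b
      proof -
        obtain H K where HK: "H \<in> C" "a \<in> H" "K \<in> C" "b \<in> K"
          using ab by blast
        then have "H \<subseteq> K \<or> K \<subseteq> H"
          using subset_chain_def chain by metis
        then show ?thesis
          using HK sub(1)[THEN subgroup.m_closed] by (meson UnionI subsetD)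
      qed
    qed
    then show "\<Union>C \<in> ?A"
      using sub by blast
  qed
  then obtain H where H: "subgroup H G" "x \<notin> H"
    and max: "\<And>K. subgroup K G \<Longrightarrow> x \<notin> K \<Longrightarrow> H \<subseteq> K \<Longrightarrow> K = H"
    by blast
  interpret H: subgroup H G by fact
  show thesis
  proof (rule that[OF H])
    fix z assume z: "z \<in> carrier G" "z \<notin> H"
    let ?K = "H <#> {\<one>, z}"
    have "inv z = z"
      using exp2 inv_equality z by blast
    then have "subgroup {\<one>, z} G"
      using z exp2 by (intro subgroupI) auto
    then have "subgroup ?K G"
      using H mult_subgroups by blast
    moreover have "H \<subseteq> ?K"
      using H.mem_carrier by (force simp: set_mult_def)
    moreover have "z \<in> ?K"
      using z H.one_closed by (force simp: set_mult_def)
    ultimately have "x \<in> ?K"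
      using max z by blast
    then obtain h where h: "h \<in> H" "x = h \<otimes> z"
      using \<open>x \<notin> H\<close> H.mem_carrier by (auto simp: set_mult_def)
    have "z \<otimes> x = h \<otimes> (z \<otimes> z)"
      using h z H.mem_carrier by (simp add: m_ac)
    then show "z \<otimes> x \<in> H"
      using h z exp2 H.mem_carrier by simp
  qed
qed

text \<open>
  The endomorphism kills a hyperplane avoiding \<open>x\<close> and is constantly \<open>y\<close> off it. It is
  multiplicative because the product of two elements off the hyperplane lies in it, while \<open>y\<^sup>2 = \<one>\<close>.
\<close>

lemma (in comm_group) exponent_two_transitive_endomorphisms:
  assumes exp2: "\<And>a. a \<in> carrier G \<Longrightarrow> a \<otimes> a = \<one>"
    and x: "x \<in> carrier G" "x \<noteq> \<one>" and y: "y \<in> carrier G"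
  shows "\<exists>f\<in>hom G G. f x = y"
proof -
  obtain H where H: "subgroup H G" "x \<notin> H"
    and index2: "\<And>z. z \<in> carrier G \<Longrightarrow> z \<notin> H \<Longrightarrow> z \<otimes> x \<in> H"
    using exponent_two_hyperplane_avoiding[OF exp2 x] by blast
  interpret H: subgroup H G by fact
  have mixed: "a \<otimes> b \<notin> H" if "a \<in> H" "b \<in> carrier G" "b \<notin> H" for a b
    using that H.mem_carrier H.m_closed H.m_inv_closed
    by (metis inv_solve_left m_closed)
  \<comment> \<open>Both \<open>a x\<close> and \<open>b x\<close> lie in \<open>H\<close>, and the two factors \<open>x\<close> cancel in their product.\<close>
  have off: "a \<otimes> b \<in> H" if ab: "a \<in> carrier G" "a \<notin> H" "b \<in> carrier G" "b \<notin> H" for a b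
  proof -
    have "(a \<otimes> x) \<otimes> (b \<otimes> x) = (a \<otimes> b) \<otimes> (x \<otimes> x)"
      using ab x by (simp add: m_ac)
    then have "a \<otimes> b = (a \<otimes> x) \<otimes> (b \<otimes> x)"
      using ab x exp2 by simp
    then show ?thesis
      using ab index2 by simp
  qed
  let ?f = "\<lambda>g. if g \<in> H then \<one> else y"
  have "?f \<in> hom G G"
  proof (rule homI)
    fix a b assume ab: "a \<in> carrier G" "b \<in> carrier G"
    show "?f (a \<otimes> b) = ?f a \<otimes> ?f b"
      using ab y exp2 mixed[of a b] mixed[of b a] off[of a b]
      by (auto simp: m_comm)
  qed (use y in auto)
  then show ?thesis
    using H by (intro bexI[of _ ?f]) auto
qed

text \<open>
  The element \<open>z\<close> excludes the group of order two, whose only non-identity element can go to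
  itself or to \<open>\<one>\<close> alone. It serves as the target in the elementary abelian case; in the other
  cases a failure of commutativity or of exponent two provides the moved element.
\<close>

lemma (in group) hom_moves_nonidentity:
  assumes x: "x \<in> carrier G" "x \<noteq> \<one>" and z: "z \<in> carrier G" "z \<noteq> \<one>" "z \<noteq> x"
  shows "\<exists>f\<in>hom G G. \<exists>u\<in>carrier G - {\<one>}. f u \<noteq> u \<and> f u \<noteq> \<one>"
proof (cases "\<exists>a\<in>carrier G. \<exists>b\<in>carrier G. a \<otimes> b \<noteq> b \<otimes> a")
  case True
  then obtain a b where ab: "a \<in> carrier G" "b \<in> carrier G" "a \<otimes> b \<noteq> b \<otimes> a"
    by blast
  let ?f = "\<lambda>g. a \<otimes> g \<otimes> inv a"
  have "inv a \<otimes> (a \<otimes> g) = g" if "g \<in> carrier G" for g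
    using ab that by (simp flip: m_assoc)
  then have "?f \<in> hom G G"
    using ab by (auto intro!: homI simp: m_assoc)
  moreover have "b \<noteq> \<one>"
    using ab by auto
  moreover have "?f b \<noteq> b"
    using ab by (simp add: inv_solve_right')
  moreover have "?f b \<noteq> \<one>"
    using ab \<open>b \<noteq> \<one>\<close> by (simp add: inv_solve_right')
  ultimately show ?thesis
    using ab by (intro bexI[of _ ?f] bexI[of _ b]) auto
next
  case False
  then interpret comm_group G
    by (intro group_comm_groupI) auto
  show ?thesis
  proof (cases "\<exists>a\<in>carrier G. a \<otimes> a \<noteq> \<one>")
    case True
    then obtain a where a: "a \<in> carrier G" "a \<otimes> a \<noteq> \<one>"
      by blast
    have "m_inv G \<in> hom G G"
      by (auto intro!: homI simp: inv_mult)
    moreover have "a \<noteq> \<one>" "inv a \<noteq> a" "inv a \<noteq> \<one>"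
      using a by (auto simp: inv_eq_1_iff) (metis r_inv)
    ultimately show ?thesis
      using a by blast
  next
    case False
    then show ?thesis
      using exponent_two_transitive_endomorphisms[of x z] x z by blast
  qed
qed

section \<open>Groups with two elements\<close>

lemma (in group) iso_integer_mod_group_2_iff:
  "G \<cong> integer_mod_group 2 \<longleftrightarrow> (\<exists>x. x \<noteq> \<one> \<and> carrier G = {\<one>, x})"
proof
  assume "G \<cong> integer_mod_group 2"
  then have "card (carrier G) = card {0..<2::int}"
    using iso_same_card by (fastforce simp: carrier_integer_mod_group)
  then have "card (carrier G) = 2"
    by simp
  then show "\<exists>x. x \<noteq> \<one> \<and> carrier G = {\<one>, x}"
    using one_closed by (metis card_2_iff doubleton_eq_iff insertE singletonD)
next
  assume "\<exists>x. x \<noteq> \<one> \<and> carrier G = {\<one>, x}"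
  then obtain x where x: "x \<noteq> \<one>" "carrier G = {\<one>, x}"
    by blast
  then have "x \<otimes> x = \<one>"
    by (metis insertCI insertE m_closed r_cancel_one singletonD)
  let ?f = "\<lambda>g. if g = \<one> then 0 else 1 :: int"
  have "?f \<in> hom G (integer_mod_group 2)"
    using x \<open>x \<otimes> x = \<one>\<close> by (auto intro!: homI simp: carrier_integer_mod_group)
  moreover have "carrier (integer_mod_group 2) = {0, 1}"
    by (auto simp: carrier_integer_mod_group)
  ultimately have "?f \<in> iso G (integer_mod_group 2)"
    using x by (auto simp: iso_def bij_betw_def)
  then show "G \<cong> integer_mod_group 2"
    by (rule is_isoI)
qed

section \<open>Triangles\<close>

lemma girth_triangle:
  assumes "{u, v, w} \<subseteq> pverts D" "{(u, v), (v, w), (w, u)} \<subseteq> parcs D"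
    and "u \<noteq> v" "v \<noteq> w" "w \<noteq> u"
  shows "girth D = 3"
proof (rule antisym)
  let ?p = "[(u, v), (v, w), (w, u)]"
  have "pre_digraph.cycle (with_proj D) ?p"
    unfolding pre_digraph.cycle_def pre_digraph.awalk_def
    using assms
    by (intro exI[of _ u]) (auto simp: pre_digraph.cas.simps pre_digraph.awalk_verts.simps)
  then have "girth D \<le> enat (length ?p)"
    unfolding girth_def by (intro INF_lower) auto
  then show "girth D \<le> 3"
    by (simp add: numeral_eq_enat numeral_3_eq_3)
  show "3 \<le> girth D"
    unfolding girth_def by (intro INF_greatest) (auto simp: numeral_eq_enat)
qed

lemma triangle_not_bipartite:
  assumes "{(u, v), (v, w), (w, u)} \<subseteq> parcs D"
  shows "\<not> bipartite D"
proof
  assume "bipartite D"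
  then obtain U V where disjoint: "U \<inter> V = {}"
    and edges: "\<forall>(x, y) \<in> parcs D. x \<in> U \<and> y \<in> V \<or> x \<in> V \<and> y \<in> U"
    unfolding bipartite_def by (elim exE conjE)
  have cross: "x \<in> U \<and> y \<in> V \<or> x \<in> V \<and> y \<in> U" if "(x, y) \<in> parcs D" for x y
    using bspec[OF edges that] by simp
  have "(u, v) \<in> parcs D" "(v, w) \<in> parcs D" "(w, u) \<in> parcs D"
    using assms by auto
  then show False
    using disjoint cross by (metis disjoint_iff)
qed

text \<open>
  The identity completes any edge between two other vertices to a triangle, since the trivial
  endomorphism sends everything to it.
\<close>

lemma (in group) endomorphism_graph_triangle:
  assumes nontrivial: "\<not> trivial_group G" and not_Z2: "\<not> G \<cong> integer_mod_group 2"
  obtains u v where "{\<one>, u, v} \<subseteq> pverts (endomorphism_graph G)"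
    "{(\<one>, u), (u, v), (v, \<one>)} \<subseteq> parcs (endomorphism_graph G)"
    "\<one> \<noteq> u" "u \<noteq> v" "v \<noteq> \<one>"
proof -
  obtain x where x: "x \<in> carrier G" "x \<noteq> \<one>"
    using nontrivial trivial_group_subset by auto
  moreover have "carrier G \<noteq> {\<one>, x}"
    using not_Z2 x iso_integer_mod_group_2_iff by blast
  ultimately obtain z where "z \<in> carrier G" "z \<noteq> \<one>" "z \<noteq> x"
    by blast
  then obtain f u where f: "f \<in> hom G G"
    and u: "u \<in> carrier G" "u \<noteq> \<one>" "f u \<noteq> u" "f u \<noteq> \<one>"
    using hom_moves_nonidentity[OF x] by blast
  have fu: "f u \<in> carrier G"
    using f u by (auto simp: hom_def)
  have "(\<lambda>_. \<one>) \<in> hom G G"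
    by (rule trivial_hom) (rule is_group)
  then show thesis
    using f u fu that[of u "f u"] by (fastforce simp: endomorphism_graph_def)
qed

theorem proposition6p7:
  fixes G :: "('a, 'b) monoid_scheme"
  assumes "group G" and "\<not> trivial_group G"
  shows "(\<not> G \<cong> integer_mod_group 2 \<longrightarrow> girth (endomorphism_graph G) = 3) \<and>
         (bipartite (endomorphism_graph G) \<longleftrightarrow> G \<cong> integer_mod_group 2)"
proof -
  interpret group G by fact
  have "bipartite (endomorphism_graph G)" if Z2: "G \<cong> integer_mod_group 2"
  proof -
    obtain x where x: "x \<noteq> \<one>\<^bsub>G\<^esub>" "carrier G = {\<one>\<^bsub>G\<^esub>, x}"
      using Z2 iso_integer_mod_group_2_iff by blast
    show ?thesis
      unfolding bipartite_def
      by (rule exI[of _ "{\<one>\<^bsub>G\<^esub>}"], rule exI[of _ "{x}"])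
         (use x in \<open>auto simp: endomorphism_graph_def\<close>)
  qed
  then show ?thesis
    using endomorphism_graph_triangle[OF assms(2)] girth_triangle triangle_not_bipartite by metis
qed

end
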